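(* Let $X \in \{\mathrm{LD},\mathrm{LTD},\mathrm{OD},\mathrm{OTD},\mathrm{ID},\mathrm{ITD},\mathrm{FD},\mathrm{FTD}\}$ and let $S\in\{L,O,I,F\}$ be the first letter of $X$ (the type of separation involved in $X$). If $G$ is an X-admissible graph on $n$ vertices with $\gamma^{X}(G)=k$, where $k\ge 2$, then $$n \le \begin{cases} 2^k+k-1 & \text{if } X \in \{\mathrm{LD},\mathrm{LTD}\},\\ 2^k & \text{if } X=\mathrm{OD},\\ 2^k-1 & \text{if } X\in\{\mathrm{OTD},\mathrm{ID},\mathrm{ITD}\},\\ 2^k-k & \text{if } X=\mathrm{FD},\\ 2^k-k-1 & \text{if } X=\mathrm{FTD}.\end{cases}$$ Moreover, equality in the respective case is achieved if and only if $G$ is isomorphic to some graph $G^S(k)=(C\cup (V\setminus C),E)$ such that $G^S(k)[C]$ is X-admissible and, if $X\in\{\mathrm{OD},\mathrm{FD}\}$, $G^S(k)[C]$ has an isolated vertex.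
   Context: Graphs are finite, simple and undirected. For a graph $G=(V,E)$ and $v\in V$, $N(v)$ is the open neighborhood and $N[v]=N(v)\cup\{v\}$ the closed neighborhood; $G[C]$ is the subgraph induced by $C$. Open twins are distinct non-adjacent $u,v$ with $N(u)=N(v)$; closed twins are distinct adjacent $u,v$ with $N[u]=N[v]$. A set $C\subseteq V$ is dominating (resp. total-dominating) if $N[v]\cap C\neq\emptyset$ (resp. $N(v)\cap C\ne\emptyset$) for all $v\in V$. It is location-separating (L-separating) if $N(u)\cap C\neq N(v)\cap C$ for all distinct $u,v\in V\setminus C$; open-separating (O-separating) if $N(u)\cap C\neq N(v)\cap C$ for all distinct $u,v\in V$; closed-separating (I-separating) if $N[u]\cap C\neq N[v]\cap C$ for all distinct $u,v\in V$; full-separating (F-separating) if it is both open- and closed-separating. For $S\in\{L,O,I,F\}$, an $S$D-code (resp. $S$TD-code) is an $S$-separating set that is dominating (resp. total-dominating); this defines LD-, LTD-, OD-, OTD-, ID-, ITD-, FD- and FTD-codes. A graph is X-admissible if it has an X-code; $\gamma^{X}(G)$ is the minimum cardinality of an X-code of $G$. $G^S(k)$ denotes any graph with vertex set $V$ and a subset $C\subseteq V$, $|C|=k$, such that: - $S=L$ ($k\ge2$): $V\setminus C$ consists of exactly one vertex $v_{C'}$ with $N(v_{C'})\cap C=C'$ for each non-empty $C'\subseteq C$; - $S=O$ ($k\ge2$): $G^O(k)[C]$ has no open twins and $V\setminus C$ consists of exactly one vertex $v_{C'}$ with $N(v_{C'})\cap C=C'$ for each non-empty $C'\subseteq C$ such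 that no $u\in C$ has $N(u)\cap C=C'$; - $S=I$ ($k\ge2$): $G^I(k)[C]$ has no closed twins and $V\setminus C$ consists of exactly one vertex $v_{C'}$ with $N(v_{C'})\cap C=C'$ for each non-empty $C'\subseteq C$ such that no $u\in C$ has $N[u]\cap C=C'$; - $S=F$ ($k\ge4$; there are no twin-free graphs on 2 or 3 vertices): $G^F(k)[C]$ has neither open nor closed twins and $V\setminus C$ consists of exactly one vertex $v_{C'}$ with $N(v_{C'})\cap C=C'$ for each non-empty $C'\subseteq C$ such that no $u\in C$ has $N(u)\cap C=C'$ or $N[u]\cap C=C'$. There is no further condition on the edges inside $C$ or inside $V\setminus C$. *)

theory Defs
  imports "Graph_Theory.Graph_Theory"
begin

text \<open>Finite simple undirected graphs are the locale predicate \<open>graph\<close> of the AFP entry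
  Graph\_Theory: finite, symmetric, loop-free digraphs without parallel arcs.\<close>

definition nbhd :: "('a,'b) pre_digraph \<Rightarrow> 'a \<Rightarrow> 'a set" where
  "nbhd G v = {u. v \<rightarrow>\<^bsub>G\<^esub> u}"

definition closed_nbhd :: "('a,'b) pre_digraph \<Rightarrow> 'a \<Rightarrow> 'a set" where
  "closed_nbhd G v = insert v (nbhd G v)"

definition open_twins :: "('a,'b) pre_digraph \<Rightarrow> 'a \<Rightarrow> 'a \<Rightarrow> bool" where
  "open_twins G u v \<longleftrightarrow> u \<in> verts G \<and> v \<in> verts G \<and> u \<noteq> v \<and>
     \<not> u \<rightarrow>\<^bsub>G\<^esub> v \<and> nbhd G u = nbhd G v"

definition closed_twins :: "('a,'b) pre_digraph \<Rightarrow> 'a \<Rightarrow> 'a \<Rightarrow> bool" where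
  "closed_twins G u v \<longleftrightarrow> u \<in> verts G \<and> v \<in> verts G \<and> u \<noteq> v \<and>
     u \<rightarrow>\<^bsub>G\<^esub> v \<and> closed_nbhd G u = closed_nbhd G v"

definition isolated :: "('a,'b) pre_digraph \<Rightarrow> 'a \<Rightarrow> bool" where
  "isolated G v \<longleftrightarrow> v \<in> verts G \<and> nbhd G v = {}"

definition dominating :: "('a,'b) pre_digraph \<Rightarrow> 'a set \<Rightarrow> bool" where
  "dominating G C \<longleftrightarrow> (\<forall>v\<in>verts G. closed_nbhd G v \<inter> C \<noteq> {})"

definition total_dominating :: "('a,'b) pre_digraph \<Rightarrow> 'a set \<Rightarrow> bool" where
  "total_dominating G C \<longleftrightarrow> (\<forall>v\<in>verts G. nbhd G v \<inter> C \<noteq> {})"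

definition location_separating :: "('a,'b) pre_digraph \<Rightarrow> 'a set \<Rightarrow> bool" where
  "location_separating G C \<longleftrightarrow>
     (\<forall>u\<in>verts G - C. \<forall>v\<in>verts G - C. u \<noteq> v \<longrightarrow> nbhd G u \<inter> C \<noteq> nbhd G v \<inter> C)"

definition open_separating :: "('a,'b) pre_digraph \<Rightarrow> 'a set \<Rightarrow> bool" where
  "open_separating G C \<longleftrightarrow>
     (\<forall>u\<in>verts G. \<forall>v\<in>verts G. u \<noteq> v \<longrightarrow> nbhd G u \<inter> C \<noteq> nbhd G v \<inter> C)"

definition closed_separating :: "('a,'b) pre_digraph \<Rightarrow> 'a set \<Rightarrow> bool" where
  "closed_separating G C \<longleftrightarrow>
     (\<forall>u\<in>verts G. \<forall>v\<in>verts G. u \<noteq> v \<longrightarrow> closed_nbhd G u \<inter> C \<noteq> closed_nbhd G v \<inter> C)"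

definition full_separating :: "('a,'b) pre_digraph \<Rightarrow> 'a set \<Rightarrow> bool" where
  "full_separating G C \<longleftrightarrow> open_separating G C \<and> closed_separating G C"

datatype separation = Sep_L | Sep_O | Sep_I | Sep_F

datatype code_type = LD | LTD | OD | OTD | ID | ITD | FD | FTD

fun separation_of :: "code_type \<Rightarrow> separation" where
  "separation_of LD = Sep_L"
| "separation_of LTD = Sep_L"
| "separation_of OD = Sep_O"
| "separation_of OTD = Sep_O"
| "separation_of ID = Sep_I"
| "separation_of ITD = Sep_I"
| "separation_of FD = Sep_F"
| "separation_of FTD = Sep_F"

fun separating :: "separation \<Rightarrow> ('a,'b) pre_digraph \<Rightarrow> 'a set \<Rightarrow> bool" where
  "separating Sep_L G C = location_separating G C"
| "separating Sep_O G C = open_separating G C"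
| "separating Sep_I G C = closed_separating G C"
| "separating Sep_F G C = full_separating G C"

definition is_code :: "code_type \<Rightarrow> ('a,'b) pre_digraph \<Rightarrow> 'a set \<Rightarrow> bool" where
  "is_code X G C \<longleftrightarrow> C \<subseteq> verts G \<and> separating (separation_of X) G C \<and>
     (if X \<in> {LTD, OTD, ITD, FTD} then total_dominating G C else dominating G C)"

definition admissible :: "code_type \<Rightarrow> ('a,'b) pre_digraph \<Rightarrow> bool" where
  "admissible X G \<longleftrightarrow> (\<exists>C. is_code X G C)"

text \<open>The value of \<open>code_number\<close> is meaningful for admissible graphs only.\<close>

definition code_number :: "code_type \<Rightarrow> ('a,'b) pre_digraph \<Rightarrow> nat" where
  "code_number X G = (LEAST m. \<exists>C. is_code X G C \<and> card C = m)"

fun min_size :: "separation \<Rightarrow> nat" where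
  "min_size Sep_L = 2"
| "min_size Sep_O = 2"
| "min_size Sep_I = 2"
| "min_size Sep_F = 4"

fun twin_condition :: "separation \<Rightarrow> ('a,'b) pre_digraph \<Rightarrow> bool" where
  "twin_condition Sep_L H \<longleftrightarrow> True"
| "twin_condition Sep_O H \<longleftrightarrow> (\<nexists>u v. open_twins H u v)"
| "twin_condition Sep_I H \<longleftrightarrow> (\<nexists>u v. closed_twins H u v)"
| "twin_condition Sep_F H \<longleftrightarrow> (\<nexists>u v. open_twins H u v) \<and> (\<nexists>u v. closed_twins H u v)"

text \<open>The subsets of \<open>C\<close> that already occur as a trace of a vertex of \<open>C\<close>.\<close>

fun used_subsets :: "separation \<Rightarrow> ('a,'b) pre_digraph \<Rightarrow> 'a set \<Rightarrow> 'a set set" where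
  "used_subsets Sep_L G C = {}"
| "used_subsets Sep_O G C = {C'. \<exists>u\<in>C. nbhd G u \<inter> C = C'}"
| "used_subsets Sep_I G C = {C'. \<exists>u\<in>C. closed_nbhd G u \<inter> C = C'}"
| "used_subsets Sep_F G C = {C'. \<exists>u\<in>C. nbhd G u \<inter> C = C' \<or> closed_nbhd G u \<inter> C = C'}"

text \<open>\<open>extremal_graph S k G C\<close>: \<open>G\<close>, with the distinguished vertex set \<open>C\<close>, is a graph \<open>G\<^sup>S(k)\<close>.
  The bijection says that \<open>verts G - C\<close> consists of exactly one vertex with
  trace \<open>C'\<close> on \<open>C\<close> for each non-empty unused \<open>C' \<subseteq> C\<close>.\<close>

definition extremal_graph :: "separation \<Rightarrow> nat \<Rightarrow> ('a,'b) pre_digraph \<Rightarrow> 'a set \<Rightarrow> bool" where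
  "extremal_graph S k G C \<longleftrightarrow>
     graph G \<and> C \<subseteq> verts G \<and> card C = k \<and> min_size S \<le> k \<and>
     twin_condition S (G \<restriction> C) \<and>
     bij_betw (\<lambda>v. nbhd G v \<inter> C) (verts G - C)
       {C'. C' \<subseteq> C \<and> C' \<noteq> {} \<and> C' \<notin> used_subsets S G C}"

text \<open>The subtractions on natural numbers do not truncate, as \<open>k + 1 \<le> 2 ^ k\<close>.\<close>

fun order_bound :: "code_type \<Rightarrow> nat \<Rightarrow> nat" where
  "order_bound LD k = 2 ^ k + k - 1"
| "order_bound LTD k = 2 ^ k + k - 1"
| "order_bound OD k = 2 ^ k"
| "order_bound OTD k = 2 ^ k - 1"
| "order_bound ID k = 2 ^ k - 1"
| "order_bound ITD k = 2 ^ k - 1"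
| "order_bound FD k = 2 ^ k - k"
| "order_bound FTD k = 2 ^ k - k - 1"

end

theory Submission
  imports Defs
begin

text \<open>For an X-code \<open>C\<close>, the traces on \<open>C\<close> of the vertices outside \<open>C\<close> are distinct, non-empty and
  different from the traces used inside \<open>C\<close>, so \<open>n - k\<close> is at most the number of non-empty unused
  subsets of \<open>C\<close>, with equality exactly when the trace map is onto these subsets. Since the
  subgraph induced by \<open>C\<close> inherits the separation, its vertices use \<open>0\<close>, \<open>k\<close>, \<open>k\<close> or \<open>2k\<close> distinct
  subsets for the four separations; the empty set is among them iff that subgraph has an isolated
  vertex and the separation is O or F.\<close>

section \<open>Neighborhoods and their traces on a vertex subset\<close>

lemma symmetric_nbhd: "graph G \<Longrightarrow> u \<in> nbhd G v \<longleftrightarrow> v \<in> nbhd G u"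
  by (auto simp: nbhd_def graph_def pseudo_graph_def intro: arcs_ends_symmetric[OF sym_digraph.sym_arcs])

lemma not_in_nbhd: "graph G \<Longrightarrow> v \<notin> nbhd G v"
  by (auto simp: nbhd_def graph_def digraph_def dest: loopfree_digraph.adj_not_same)

lemma finite_verts_graph: "graph G \<Longrightarrow> finite (verts G)"
  by (simp add: graph_def digraph_def fin_digraph.finite_verts)

lemma nbhd_induce_subgraph: "v \<in> C \<Longrightarrow> nbhd (G \<restriction> C) v = nbhd G v \<inter> C"
  by (auto simp: nbhd_def arcs_ends_conv image_iff)

lemma closed_nbhd_induce_subgraph: "v \<in> C \<Longrightarrow> closed_nbhd (G \<restriction> C) v = closed_nbhd G v \<inter> C"
  by (simp add: closed_nbhd_def nbhd_induce_subgraph)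

lemma closed_nbhd_inter_outside: "v \<notin> C \<Longrightarrow> closed_nbhd G v \<inter> C = nbhd G v \<inter> C"
  by (simp add: closed_nbhd_def)

lemma isolated_induce_subgraph:
  "isolated (G \<restriction> C) v \<longleftrightarrow> v \<in> C \<and> nbhd G v \<inter> C = {}"
  by (auto simp: isolated_def nbhd_induce_subgraph)

section \<open>Twin-free induced subgraphs\<close>

lemma no_open_twins_iff_inj_on:
  assumes "graph G"
  shows "(\<nexists>u v. open_twins (G \<restriction> C) u v) \<longleftrightarrow> inj_on (\<lambda>v. nbhd G v \<inter> C) C"
proof -
  \<comment> \<open>The non-adjacency demanded of open twins is automatic: adjacent vertices with
    equal open traces would produce a loop.\<close>
  have "\<not> u \<rightarrow>\<^bsub>G \<restriction> C\<^esub> v" if "u \<in> C" "v \<in> C" "nbhd G u \<inter> C = nbhd G v \<inter> C" for u v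
  proof
    assume "u \<rightarrow>\<^bsub>G \<restriction> C\<^esub> v"
    then have "v \<in> nbhd (G \<restriction> C) u"
      by (simp add: nbhd_def)
    then have "v \<in> nbhd G v"
      using that by (auto simp: nbhd_induce_subgraph)
    then show False
      using not_in_nbhd[OF assms] by blast
  qed
  then show ?thesis
    by (auto simp: open_twins_def inj_on_def nbhd_induce_subgraph)
qed

text \<open>The adjacency demanded of closed twins is automatic: \<open>v\<close> lies in its own
  closed trace, hence in that of \<open>u\<close>, and \<open>u \<noteq> v\<close>.\<close>

lemma no_closed_twins_iff_inj_on:
  "(\<nexists>u v. closed_twins (G \<restriction> C) u v) \<longleftrightarrow> inj_on (\<lambda>v. closed_nbhd G v \<inter> C) C"
proof -
  have "u \<rightarrow>\<^bsub>G \<restriction> C\<^esub> v" if "u \<in> C" "v \<in> C" "u \<noteq> v" "closed_nbhd G u \<inter> C = closed_nbhd G v \<inter> C"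
    for u v
  proof -
    have "v \<in> nbhd (G \<restriction> C) u"
      using that by (auto simp: nbhd_induce_subgraph closed_nbhd_def)
    then show ?thesis
      by (simp add: nbhd_def)
  qed
  then show ?thesis
    by (auto simp: closed_twins_def inj_on_def closed_nbhd_induce_subgraph)
qed

text \<open>Two vertices are twins unless a third vertex is adjacent to exactly one of them. With
  two vertices there is no third one; with three, the three possible edges would need pairwise
  different truth values.\<close>

lemma card_twin_free_ge_4:
  assumes "graph G" "finite C" "2 \<le> card C"
    and open_inj: "inj_on (\<lambda>v. nbhd G v \<inter> C) C"
    and closed_inj: "inj_on (\<lambda>v. closed_nbhd G v \<inter> C) C"
  shows "4 \<le> card C"
proof (rule ccontr)
  assume "\<not> 4 \<le> card C"
  then have card: "card C = 2 \<or> card C = 3"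
    using assms(3) by linarith
  note sym = symmetric_nbhd[OF assms(1)] and irrefl = not_in_nbhd[OF assms(1)]
  have third: "\<exists>w\<in>C - {u, v}. w \<in> nbhd G u \<longleftrightarrow> w \<notin> nbhd G v"
    if uv: "u \<in> C" "v \<in> C" "u \<noteq> v" for u v
  proof (rule ccontr)
    assume "\<not> ?thesis"
    then have same: "w \<in> nbhd G u \<longleftrightarrow> w \<in> nbhd G v" if "w \<in> C" "w \<noteq> u" "w \<noteq> v" for w
      using that by blast
    \<comment> \<open>If no third vertex tells \<open>u\<close> and \<open>v\<close> apart, they are
      closed twins when adjacent and open twins otherwise.\<close>
    show False
    proof (cases "v \<in> nbhd G u")
      case True
      then have "closed_nbhd G u \<inter> C = closed_nbhd G v \<inter> C"
        using same sym[of u v] unfolding closed_nbhd_def by blast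
      then show False
        using inj_onD[OF closed_inj _ uv(1,2)] uv(3) by blast
    next
      case False
      have "nbhd G u \<inter> C = nbhd G v \<inter> C"
      proof (rule set_eqI)
        fix w
        show "w \<in> nbhd G u \<inter> C \<longleftrightarrow> w \<in> nbhd G v \<inter> C"
          using same[of w] False sym[of u v] irrefl[of u] irrefl[of v]
          by (cases "w = u"; cases "w = v"; cases "w \<in> C") simp_all
      qed
      then show False
        using inj_onD[OF open_inj _ uv(1,2)] uv(3) by blast
    qed
  qed
  from card show False
  proof
    assume "card C = 2"
    then obtain a b where "C = {a, b}" "a \<noteq> b"
      by (auto simp: card_2_iff)
    then show False
      using third[of a b] by simp
  next
    assume "card C = 3"
    then obtain a b c where C: "C = {a, b, c}" "a \<noteq> b" "a \<noteq> c" "b \<noteq> c"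
      by (auto simp: card_3_iff)
    have "C - {a, b} = {c}" "C - {a, c} = {b}" "C - {b, c} = {a}"
      using C by auto
    \<comment> \<open>Each pair can only be told apart by the one remaining vertex.\<close>
    then have "c \<in> nbhd G a \<longleftrightarrow> c \<notin> nbhd G b" "b \<in> nbhd G a \<longleftrightarrow> b \<notin> nbhd G c"
        "a \<in> nbhd G b \<longleftrightarrow> a \<notin> nbhd G c"
      using third[of a b] third[of a c] third[of b c] C by simp_all
    then show False
      using sym[of a b] sym[of a c] sym[of b c] by blast
  qed
qed

section \<open>Counting used and free subsets\<close>

fun uses_per_vertex :: "separation \<Rightarrow> nat" where
  "uses_per_vertex Sep_L = 0"
| "uses_per_vertex Sep_O = 1"
| "uses_per_vertex Sep_I = 1"
| "uses_per_vertex Sep_F = 2"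

text \<open>A vertex of \<open>C\<close> contributes no trace for L, its open trace for O, its
  closed trace for I and both for F. Absence of the respective twins makes traces of the same sort
  distinct.\<close>

lemma card_used_subsets:
  assumes "graph G" "finite C" "twin_condition S (G \<restriction> C)"
  shows "card (used_subsets S G C) = uses_per_vertex S * card C"
proof (cases S)
  case Sep_O
  then show ?thesis
    using assms card_image[of "\<lambda>v. nbhd G v \<inter> C" C] no_open_twins_iff_inj_on[OF assms(1), of C]
    by (auto simp: image_def eq_commute)
next
  case Sep_I
  then show ?thesis
    using assms card_image[of "\<lambda>v. closed_nbhd G v \<inter> C" C] no_closed_twins_iff_inj_on[of G C]
    by (auto simp: image_def eq_commute)
next
  case Sep_F
  let ?O = "(\<lambda>v. nbhd G v \<inter> C) ` C" and ?I = "(\<lambda>v. closed_nbhd G v \<inter> C) ` C"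
  have inj: "inj_on (\<lambda>v. nbhd G v \<inter> C) C" "inj_on (\<lambda>v. closed_nbhd G v \<inter> C) C"
    using assms Sep_F no_open_twins_iff_inj_on[OF assms(1), of C] no_closed_twins_iff_inj_on[of G C]
    by auto
  \<comment> \<open>An open trace never equals a closed one: equality gives
    \<open>v \<in> nbhd G u\<close>, so by symmetry \<open>u\<close> lies in the closed trace of
    \<open>v\<close>, hence in its own open neighborhood.\<close>
  have "nbhd G u \<inter> C \<noteq> closed_nbhd G v \<inter> C" if "u \<in> C" "v \<in> C" for u v
  proof
    assume eq: "nbhd G u \<inter> C = closed_nbhd G v \<inter> C"
    then have "v \<in> nbhd G u"
      using that by (auto simp: closed_nbhd_def)
    then have "u \<in> closed_nbhd G v \<inter> C"
      using that symmetric_nbhd[OF assms(1)] by (auto simp: closed_nbhd_def)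
    then show False
      using eq not_in_nbhd[OF assms(1)] by blast
  qed
  then have "?O \<inter> ?I = {}"
    by blast
  moreover have "used_subsets S G C = ?O \<union> ?I"
    using Sep_F by auto
  ultimately show ?thesis
    using Sep_F assms(2) by (simp add: card_Un_disjoint card_image[OF inj(1)] card_image[OF inj(2)])
qed simp

abbreviation free_subsets :: "separation \<Rightarrow> ('a,'b) pre_digraph \<Rightarrow> 'a set \<Rightarrow> 'a set set" where
  "free_subsets S G C \<equiv> {C'. C' \<subseteq> C \<and> C' \<noteq> {} \<and> C' \<notin> used_subsets S G C}"

lemma used_subsets_subset_Pow: "used_subsets S G C \<subseteq> Pow C"
  by (cases S) auto

lemma empty_in_used_subsets_iff:
  "{} \<in> used_subsets S G C \<longleftrightarrow> S \<in> {Sep_O, Sep_F} \<and> (\<exists>v. isolated (G \<restriction> C) v)"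
  by (cases S) (auto simp: isolated_induce_subgraph closed_nbhd_def)

text \<open>The non-free members of \<open>Pow C\<close> are the used subsets and \<open>{}\<close>;
  the latter costs an extra 1 unless it is itself a used trace. The additive form avoids truncated
  subtraction.\<close>

lemma card_free_subsets:
  assumes "graph G" "finite C" "twin_condition S (G \<restriction> C)"
  shows "card (free_subsets S G C) + uses_per_vertex S * card C
    + (if S \<in> {Sep_O, Sep_F} \<and> (\<exists>v. isolated (G \<restriction> C) v) then 0 else 1) = 2 ^ card C"
proof -
  let ?U = "used_subsets S G C"
  have fin: "finite ?U"
    using used_subsets_subset_Pow assms(2) by (metis finite_Pow_iff finite_subset)
  have "free_subsets S G C = Pow C - insert {} ?U"
    by auto
  moreover have "insert {} ?U \<subseteq> Pow C"
    using used_subsets_subset_Pow by blast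
  ultimately have "card (free_subsets S G C) + card (insert {} ?U) = 2 ^ card C"
    using assms(2) fin
    by (metis card_Diff_subset card_Pow card_mono finite_Pow_iff finite_insert le_add_diff_inverse2)
  then show ?thesis
    using card_insert_if[OF fin, of "{}"] card_used_subsets[OF assms]
    by (cases "{} \<in> ?U") (simp_all only: empty_in_used_subsets_iff if_True if_False, simp_all)
qed

text \<open>The hypotheses fit both a code of \<open>G\<close> and the distinguished set of an
  extremal graph, so one count serves both directions of the equality case. An isolated vertex gains
  1 for O and F, and exactly the bounds for OD and FD include this gain.\<close>

lemma card_add_card_free_subsets:
  assumes "graph G" "C \<subseteq> verts G" "twin_condition (separation_of X) (G \<restriction> C)"
    and "admissible X (G \<restriction> C)"
  shows "card C + card (free_subsets (separation_of X) G C) \<le> order_bound X (card C)"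
    and "card C + card (free_subsets (separation_of X) G C) = order_bound X (card C) \<longleftrightarrow>
      (X \<in> {OD, FD} \<longrightarrow> (\<exists>v. isolated (G \<restriction> C) v))"
proof -
  have "finite C"
    using assms(1,2) finite_verts_graph finite_subset by blast
  note count = card_free_subsets[OF assms(1) this assms(3)]
  \<comment> \<open>A total-dominating set meets every open neighborhood, so none of these can be
    empty.\<close>
  have "\<nexists>v. isolated (G \<restriction> C) v" if X: "X \<in> {OTD, FTD}"
  proof -
    obtain D where "is_code X (G \<restriction> C) D"
      using assms(4) by (auto simp: admissible_def)
    then have "total_dominating (G \<restriction> C) D"
      using X by (simp add: is_code_def split: if_splits)
    then show ?thesis
      unfolding total_dominating_def isolated_def by blast
  qed
  then show "card C + card (free_subsets (separation_of X) G C) \<le> order_bound X (card C)"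
    and "card C + card (free_subsets (separation_of X) G C) = order_bound X (card C) \<longleftrightarrow>
      (X \<in> {OD, FD} \<longrightarrow> (\<exists>v. isolated (G \<restriction> C) v))"
    using count by (cases X; auto split: if_splits)+
qed

section \<open>Codes and the traces of outer vertices\<close>

lemma is_code_induce_subgraph:
  assumes "is_code X G C"
  shows "is_code X (G \<restriction> C) C"
proof -
  \<comment> \<open>All conditions see neighborhoods only through their traces on \<open>C\<close>,
    which \<open>G \<restriction> C\<close> preserves; location-separation becomes vacuous.\<close>
  have "separating S (G \<restriction> C) C" if "C \<subseteq> verts G" "separating S G C" for S
    using that
    by (cases S) (auto simp: location_separating_def open_separating_def closed_separating_def
        full_separating_def nbhd_induce_subgraph closed_nbhd_induce_subgraph subset_iff)
  moreover have "dominating G C \<Longrightarrow> C \<subseteq> verts G \<Longrightarrow> dominating (G \<restriction> C) C"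
    by (auto simp: dominating_def closed_nbhd_induce_subgraph subset_iff)
  moreover have "total_dominating G C \<Longrightarrow> C \<subseteq> verts G \<Longrightarrow> total_dominating (G \<restriction> C) C"
    by (auto simp: total_dominating_def nbhd_induce_subgraph subset_iff)
  ultimately show ?thesis
    using assms by (auto simp: is_code_def split: if_splits)
qed

lemma twin_condition_separating:
  assumes "graph G" "C \<subseteq> verts G" "separating S G C"
  shows "twin_condition S (G \<restriction> C)"
proof -
  have "inj_on (\<lambda>v. nbhd G v \<inter> C) C" if "open_separating G C"
    using that assms(2) by (auto simp: open_separating_def inj_on_def)
  moreover have "inj_on (\<lambda>v. closed_nbhd G v \<inter> C) C" if "closed_separating G C"
    using that assms(2) by (auto simp: closed_separating_def inj_on_def)
  ultimately show ?thesis
    using assms(3) no_open_twins_iff_inj_on[OF assms(1), of C] no_closed_twins_iff_inj_on[of G C]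
    by (cases S) (auto simp: full_separating_def)
qed

text \<open>Only \<open>Sep_F\<close> asks for more than 2, and there twin-freeness supplies
  4.\<close>

lemma min_size_le:
  assumes "graph G" "finite C" "2 \<le> card C" "twin_condition S (G \<restriction> C)"
  shows "min_size S \<le> card C"
  using assms card_twin_free_ge_4[OF assms(1-3)]
    no_open_twins_iff_inj_on[OF assms(1), of C] no_closed_twins_iff_inj_on[of G C]
  by (cases S) auto

text \<open>Outside \<open>C\<close> open and closed traces coincide. Hence every kind of separation
  distinguishes outer vertices by open traces, and an outer trace can be compared with either sort
  of trace used inside \<open>C\<close>.\<close>

lemma separating_outside:
  assumes "C \<subseteq> verts G" "separating S G C"
  shows "inj_on (\<lambda>v. nbhd G v \<inter> C) (verts G - C)"
    and "v \<in> verts G - C \<Longrightarrow> nbhd G v \<inter> C \<notin> used_subsets S G C"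
proof -
  show "inj_on (\<lambda>v. nbhd G v \<inter> C) (verts G - C)"
  proof (rule inj_onI, rule ccontr)
    fix u v
    assume uv: "u \<in> verts G - C" "v \<in> verts G - C" "nbhd G u \<inter> C = nbhd G v \<inter> C" "u \<noteq> v"
    moreover have "closed_nbhd G u \<inter> C = closed_nbhd G v \<inter> C"
      using uv by (simp add: closed_nbhd_inter_outside)
    moreover have "u \<in> verts G" "v \<in> verts G"
      using uv by auto
    ultimately show False
      using assms(2) unfolding separating.simps
      by (cases S; simp add: full_separating_def)
        (unfold location_separating_def open_separating_def closed_separating_def, blast+)
  qed
next
  assume v: "v \<in> verts G - C"
  have u: "u \<in> verts G" "v \<in> verts G" "u \<noteq> v" if "u \<in> C" for u
    using that v assms(1) by auto
  have "nbhd G u \<inter> C \<noteq> nbhd G v \<inter> C" if "open_separating G C" "u \<in> C" for u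
    using that(1) u[OF that(2)] by (simp add: open_separating_def)
  moreover have "closed_nbhd G u \<inter> C \<noteq> nbhd G v \<inter> C" if "closed_separating G C" "u \<in> C" for u
  proof -
    have "closed_nbhd G u \<inter> C \<noteq> closed_nbhd G v \<inter> C"
      using that(1) u[OF that(2)] by (simp add: closed_separating_def)
    then show ?thesis
      using v by (simp add: closed_nbhd_inter_outside)
  qed
  ultimately show "nbhd G v \<inter> C \<notin> used_subsets S G C"
    using assms(2) by (cases S) (auto simp: full_separating_def)
qed

lemma traces_outside_code:
  assumes "is_code X G C"
  shows "(\<lambda>v. nbhd G v \<inter> C) ` (verts G - C) \<subseteq> free_subsets (separation_of X) G C"
proof -
  have "nbhd G v \<inter> C \<noteq> {}" if "v \<in> verts G - C" for v
  proof -
    have "dominating G C \<or> total_dominating G C"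
      using assms by (auto simp: is_code_def split: if_splits)
    moreover have "closed_nbhd G v \<inter> C = nbhd G v \<inter> C"
      using that by (simp add: closed_nbhd_inter_outside)
    ultimately show ?thesis
      using that unfolding dominating_def total_dominating_def by (metis DiffD1)
  qed
  then show ?thesis
    using assms separating_outside(2)[of C G "separation_of X"] by (auto simp: is_code_def)
qed

section \<open>Minimum codes, isomorphism and the order bound\<close>

lemma admissible_code_number:
  assumes "admissible X G"
  obtains C where "is_code X G C" "card C = code_number X G"
proof -
  have "\<exists>m C. is_code X G C \<and> card C = m"
    using assms by (simp add: admissible_def)
  then have "\<exists>C. is_code X G C \<and> card C = code_number X G"
    unfolding code_number_def by (rule LeastI_ex)
  then show ?thesis
    using that by blast
qed

lemma card_verts_digraph_iso:
  assumes "digraph_iso G H"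
  shows "card (verts G) = card (verts H)"
  using assms
  by (auto simp: digraph_iso_def pre_digraph.digraph_isomorphism_def card_image)

lemma digraph_iso_refl:
  assumes "wf_digraph G"
  shows "digraph_iso G G"
proof -
  \<comment> \<open>An isomorphism record carries the head and tail maps of its target, so the
    identity takes those of \<open>G\<close>.\<close>
  let ?f = "\<lparr>iso_verts = id, iso_arcs = id, iso_head = head G, iso_tail = tail G\<rparr>"
  have "pre_digraph.digraph_isomorphism G ?f"
    using assms by (simp add: pre_digraph.digraph_isomorphism_def)
  moreover have "G = app_iso ?f G"
    by (simp add: app_iso_def)
  ultimately show ?thesis
    unfolding digraph_iso_def by blast
qed

theorem corollary2:
  fixes G :: "('a,'b) pre_digraph" and X :: code_type and n k :: nat
  assumes "graph G"
    and "admissible X G"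
    and "card (verts G) = n"
    and "code_number X G = k"
    and "2 \<le> k"
  shows "n \<le> order_bound X k \<and>
    (n = order_bound X k \<longleftrightarrow>
      (\<exists>(H :: ('a,'b) pre_digraph) C.
         extremal_graph (separation_of X) k H C \<and> digraph_iso G H \<and>
         admissible X (H \<restriction> C) \<and>
         (X \<in> {OD, FD} \<longrightarrow> (\<exists>v. isolated (H \<restriction> C) v))))"
    (is "_ \<and> (_ \<longleftrightarrow> ?extremal)")
proof -
  let ?S = "separation_of X"
  obtain C where C: "is_code X G C" "card C = k"
    using admissible_code_number[OF assms(2)] assms(4) by metis
  let ?trace = "\<lambda>v. nbhd G v \<inter> C" and ?F = "free_subsets ?S G C"
  have sub: "C \<subseteq> verts G" and sep: "separating ?S G C"
    using C(1) by (auto simp: is_code_def)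
  have fin: "finite (verts G)" "finite C"
    using finite_verts_graph[OF assms(1)] finite_subset[OF sub] by auto
  have twin: "twin_condition ?S (G \<restriction> C)"
    by (rule twin_condition_separating[OF assms(1) sub sep])
  have adm: "admissible X (G \<restriction> C)"
    using is_code_induce_subgraph[OF C(1)] by (auto simp: admissible_def)
  have finF: "finite ?F"
    using fin(2) by simp
  note inj = separating_outside(1)[OF sub sep] and into = traces_outside_code[OF C(1)]
  \<comment> \<open>Injectivity of the trace map turns the count of outer vertices into a count of
    traces.\<close>
  have n: "n = k + card (?trace ` (verts G - C))"
    using assms(3) C(2) card_image[OF inj] card_Diff_subset[OF fin(2) sub] card_mono[OF fin(1) sub]
    by simp
  note bound = card_add_card_free_subsets[OF assms(1) sub twin adm, unfolded C(2)]
  have le: "card (?trace ` (verts G - C)) \<le> card ?F"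
    by (rule card_mono[OF finF into])
  have "?extremal" if "n = order_bound X k"
  proof -
    have eq: "card (?trace ` (verts G - C)) = card ?F"
        "k + card ?F = order_bound X k"
      using that n le bound(1) by linarith+
    have "bij_betw ?trace (verts G - C) ?F"
      using inj card_subset_eq[OF finF into eq(1)] by (simp add: bij_betw_def)
    then have "extremal_graph ?S k G C"
      using assms(1,5) sub C(2) twin min_size_le[OF assms(1) fin(2) _ twin]
      by (simp add: extremal_graph_def)
    moreover have "digraph_iso G G"
      using assms(1) by (intro digraph_iso_refl) (simp add: graph_def digraph_def fin_digraph_def)
    ultimately show ?thesis
      using adm eq(2) bound(2) by blast
  qed
  \<comment> \<open>The converse compares orders only: isomorphism preserves the number of vertices,
    and the bijection counts those of \<open>H\<close> outside \<open>D\<close>.\<close>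
  moreover have "n = order_bound X k" if extremal: "?extremal"
  proof -
    obtain H :: "('a,'b) pre_digraph" and D where
      H: "extremal_graph ?S k H D" "digraph_iso G H" "admissible X (H \<restriction> D)"
        "X \<in> {OD, FD} \<longrightarrow> (\<exists>v. isolated (H \<restriction> D) v)"
      using extremal by blast
    then have D: "graph H" "D \<subseteq> verts H" "card D = k" "twin_condition ?S (H \<restriction> D)"
        "bij_betw (\<lambda>v. nbhd H v \<inter> D) (verts H - D) (free_subsets ?S H D)"
      by (auto simp: extremal_graph_def)
    have finH: "finite (verts H)" "finite D"
      using finite_verts_graph[OF D(1)] finite_subset[OF D(2)] by auto
    have "n = k + card (verts H - D)"
      using assms(3) card_verts_digraph_iso[OF H(2)] D(3) card_Diff_subset[OF finH(2) D(2)]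
        card_mono[OF finH(1) D(2)] by simp
    also have "\<dots> = k + card (free_subsets ?S H D)"
      using bij_betw_same_card[OF D(5)] by simp
    also have "\<dots> = order_bound X k"
      using card_add_card_free_subsets(2)[OF D(1,2,4) H(3)] H(4) D(3) by blast
    finally show ?thesis .
  qed
  moreover have "n \<le> order_bound X k"
    using n le bound(1) by linarith
  ultimately show ?thesis
    by blast
qed

end
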